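(* Let $k\ge 2$ be an integer. Define \[P_k(z)=\frac{(2\pi)^{2k-1}}{(2k)!}\sum_{j=0}^{k}(-1)^j B_{2j}B_{2k-2j}\binom{2k}{2j}z^{2j}+\zeta(2k-1)\left(z^{2k-1}+(-1)^k z\right),\] \[Q_k(z)=\left(2^{2k}+1\right)P_{k}(z)-2^{2k}P_{k}(z/2)-P_{k}(2z),\] and \[Y_{k}(z)=\frac{\pi}{2^{2k}}\left(Q_{k}(i \sqrt{z})+Q_{k}(-i\sqrt{z})\right),\] which equals the polynomial \[Y_k(z)=\frac{\pi^{2k}}{(2k)!}\sum_{j=0}^k B_{2j}B_{2k-2j}(2^{2j}-1)(2^{2k-2j}-1)\binom{2k}{2j} z^{j}.\] Then all of the non-zero roots of $Y_k(z)$ lie on the unit circle $|z|=1$, and all of the zeros of $Y_k(z)$ are simple.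
   Context: $B_n$ denotes the $n$th Bernoulli number, defined by $\dfrac{t}{e^t-1}=\sum_{n\ge0}B_n\dfrac{t^n}{n!}$, and $\zeta$ is the Riemann zeta function. *)

theory Defs
  imports "HOL-Analysis.Analysis" "HOL-Computational_Algebra.Computational_Algebra"
begin

definition bernoulli :: "nat \<Rightarrow> real" where
  "bernoulli n = fact n * fps_nth (fps_X / (fps_exp 1 - 1)) n"

text \<open>The quotient of power series is exact, although the denominator has
  constant coefficient \<open>0\<close>.\<close>

lemma bernoulli_generating_function:
  "Abs_fps (\<lambda>n. bernoulli n / fact n) * (fps_exp 1 - 1) = fps_X"
proof -
  have nz: "fps_exp 1 - 1 \<noteq> (0 :: real fps)"
  proof
    assume "fps_exp 1 - 1 = (0 :: real fps)"
    then have "fps_nth (fps_exp 1 - 1 :: real fps) 1 = 0" by simp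
    then show False by simp
  qed
  have "subdegree (fps_exp 1 - 1 :: real fps) = 1"
    by (rule subdegreeI) auto
  then have "(fps_exp 1 - 1 :: real fps) dvd fps_X"
    using nz by (simp add: fps_dvd_iff)
  then have "fps_X / (fps_exp 1 - 1) * (fps_exp 1 - 1) = (fps_X :: real fps)"
    by simp
  moreover have "Abs_fps (\<lambda>n. bernoulli n / fact n) = fps_X / (fps_exp 1 - 1)"
    by (simp add: fps_eq_iff bernoulli_def)
  ultimately show ?thesis by simp
qed

text \<open>The Riemann zeta function on the half-plane \<open>Re s > 1\<close>, where it is given by its
  Dirichlet series. The definition is meaningless elsewhere; below it is only evaluated
  at \<open>s = 2k - 1 \<ge> 3\<close>.\<close>

definition zeta :: "complex \<Rightarrow> complex" where
  "zeta s = (\<Sum>n. 1 / of_nat (Suc n) powr s)"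

definition P_k :: "nat \<Rightarrow> complex \<Rightarrow> complex" where
  "P_k k z =
     (2 * of_real pi) ^ (2 * k - 1) / fact (2 * k) *
       (\<Sum>j=0..k. (-1) ^ j * of_real (bernoulli (2 * j)) * of_real (bernoulli (2 * k - 2 * j)) *
                  of_nat ((2 * k) choose (2 * j)) * z ^ (2 * j))
     + zeta (of_nat (2 * k - 1)) * (z ^ (2 * k - 1) + (-1) ^ k * z)"

definition Q_k :: "nat \<Rightarrow> complex \<Rightarrow> complex" where
  "Q_k k z = (2 ^ (2 * k) + 1) * P_k k z - 2 ^ (2 * k) * P_k k (z / 2) - P_k k (2 * z)"

definition Y_k :: "nat \<Rightarrow> complex \<Rightarrow> complex" where
  "Y_k k z = of_real pi / 2 ^ (2 * k) * (Q_k k (\<i> * csqrt z) + Q_k k (- \<i> * csqrt z))"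

definition Y_poly :: "nat \<Rightarrow> complex poly" where
  "Y_poly k =
     smult (of_real pi ^ (2 * k) / fact (2 * k))
       (\<Sum>j=0..k. monom (of_real (bernoulli (2 * j)) * of_real (bernoulli (2 * k - 2 * j)) *
                         (2 ^ (2 * j) - 1) * (2 ^ (2 * k - 2 * j) - 1) *
                         of_nat ((2 * k) choose (2 * j))) j)"

end

theory Submission
  imports Defs
begin

text \<open>
  With \<open>\<lambda>(s) = \<Sum> 1 / (2 n + 1) ^ s\<close>, the partial fraction expansion of the tangent gives
  \<open>(2 ^ (2 j) - 1) B\<^sub>2\<^sub>j pi ^ (2 j) / (2 j)! = - 2 (- 1) ^ j \<lambda>(2 j)\<close>, so \<open>Y\<^sub>k\<close> is up to a constant
  \<open>z\<close> times the palindromic polynomial of degree \<open>m = k - 2\<close> with coefficients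
  \<open>\<lambda>(2 j) \<lambda>(2 k - 2 j)\<close>. Since \<open>\<Sum> (\<lambda>(2 j) - 1) = \<Sum> 1 / ((2 n + 3)\<^sup>2 - 1) = 1 / 4\<close>, these
  coefficients differ from those of \<open>1 + z + \<dots> + z ^ m\<close> by less than \<open>1\<close> in total. Such a
  polynomial has \<open>m\<close> sign changes on the unit circle, hence \<open>m\<close> distinct roots there.
\<close>

section \<open>Partial fractions of the tangent\<close>

text \<open>Both sides of the reflection formula
  \<open>rGamma w * rGamma (1 - w) = sin (pi w) / pi\<close> are differentiated at \<open>z\<close>;
  dividing by the common value, nonzero off the integers, leaves the claim.\<close>

lemma Digamma_reflection_complex:
  fixes z :: complex
  assumes "z \<notin> \<int>"
  shows "Digamma (1 - z) - Digamma z = of_real pi * cot (of_real pi * z)"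
proof -
  have nz: "z \<notin> \<int>\<^sub>\<le>\<^sub>0" "1 - z \<notin> \<int>\<^sub>\<le>\<^sub>0"
  proof -
    show "z \<notin> \<int>\<^sub>\<le>\<^sub>0" using assms by (auto elim!: nonpos_Ints_cases)
    show "1 - z \<notin> \<int>\<^sub>\<le>\<^sub>0"
    proof
      assume "1 - z \<in> \<int>\<^sub>\<le>\<^sub>0"
      then have "1 - (1 - z) \<in> \<int>" by (intro Ints_diff Ints_1 nonpos_Ints_Int)
      then show False using assms by simp
    qed
  qed
  have "((\<lambda>w. rGamma w * rGamma (1 - w)) has_field_derivative
          rGamma z * rGamma (1 - z) * (Digamma (1 - z) - Digamma z)) (at z)"
    using nz by (auto intro!: derivative_eq_intros simp: algebra_simps)
  moreover have "((\<lambda>w. sin (of_real pi * w) / of_real pi) has_field_derivative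
          cos (of_real pi * z)) (at z)"
    by (auto intro!: derivative_eq_intros)
  ultimately have "rGamma z * rGamma (1 - z) * (Digamma (1 - z) - Digamma z) = cos (of_real pi * z)"
    unfolding rGamma_reflection_complex by (rule DERIV_unique)
  moreover have "sin (of_real pi * z) \<noteq> 0"
    using assms by (auto simp: sin_eq_0 mult.commute)
  ultimately show ?thesis
    unfolding rGamma_reflection_complex by (simp add: cot_def field_simps)
qed

lemma odd_plus_minus_nonzero:
  fixes z :: complex
  assumes "cmod z < 1"
  shows "of_nat (2 * n + 1) - z \<noteq> 0" "of_nat (2 * n + 1) + z \<noteq> 0"
proof -
  have "cmod (of_nat (2 * n + 1)) \<ge> 1" unfolding norm_of_nat by simp
  then show "of_nat (2 * n + 1) - z \<noteq> 0" "of_nat (2 * n + 1) + z \<noteq> 0"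
    using assms by (metis eq_iff_diff_eq_0 not_le, metis add_eq_0_iff norm_minus_cancel not_le)
qed

text \<open>For \<open>w = (1 - z) / 2\<close>, the numbers \<open>w + n\<close> and
  \<open>1 - w + n\<close> are the halves of \<open>2 n + 1 - z\<close> and
  \<open>2 n + 1 + z\<close>. The difference of the Digamma series at \<open>1 - w\<close> and
  \<open>w\<close> is therefore four times the series here, and reflection turns
  \<open>cot (pi w)\<close> into \<open>tan (pi z / 2)\<close>.\<close>

lemma tan_partial_fractions:
  fixes z :: complex
  assumes "cmod z < 1"
  shows "(\<lambda>n. z / (of_nat (2 * n + 1) ^ 2 - z ^ 2)) sums (of_real pi / 4 * tan (of_real pi * z / 2))"
proof -
  define w where "w = (1 - z) / 2"
  have re: "\<bar>Re z\<bar> < 1" using abs_Re_le_cmod[of z] assms by linarith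
  have w: "w \<notin> \<int>"
  proof
    assume "w \<in> \<int>"
    then obtain m where "w = of_int m" by (auto elim: Ints_cases)
    then have "(1 - Re z) / 2 = of_int m" by (simp add: w_def complex_eq_iff)
    then have "0 < real_of_int m" "real_of_int m < 1" using re by auto
    then have "0 < m" "m < 1" by (simp_all only: of_int_0_less_iff of_int_less_1_iff)
    then show False by simp
  qed
  then have "w \<noteq> 0" "1 - w \<noteq> 0" by auto
  have D: "(\<lambda>n. inverse (of_nat (Suc n)) - inverse (v + of_nat n)) sums (Digamma v + euler_mascheroni)"
    if "v \<noteq> 0" for v :: complex
    using summable_sums[OF summable_Digamma[OF that]] by (simp add: Digamma_def)
  \<comment> \<open>The terms \<open>1 / (n + 1)\<close> and the Euler-Mascheroni constant cancel in
    the difference.\<close>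
  have "(\<lambda>n. (inverse (w + of_nat n) - inverse (1 - w + of_nat n)) / 4)
          sums ((Digamma (1 - w) - Digamma w) / 4)"
    using sums_divide[OF sums_diff[OF D[OF \<open>1 - w \<noteq> 0\<close>] D[OF \<open>w \<noteq> 0\<close>]], of 4] by simp
  also have "(\<lambda>n. (inverse (w + of_nat n) - inverse (1 - w + of_nat n)) / 4)
      = (\<lambda>n. z / (of_nat (2 * n + 1) ^ 2 - z ^ 2))"
  proof
    fix n :: nat
    define N :: complex where "N = of_nat (2 * n + 1)"
    have N: "N - z \<noteq> 0" "N + z \<noteq> 0" using odd_plus_minus_nonzero[OF assms] unfolding N_def by auto
    have e: "w + of_nat n = (N - z) / 2" "1 - w + of_nat n = (N + z) / 2"
      by (simp_all add: w_def N_def field_simps)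
    have f: "N ^ 2 - z ^ 2 = (N - z) * (N + z)" by (simp add: power2_eq_square algebra_simps)
    show "(inverse (w + of_nat n) - inverse (1 - w + of_nat n)) / 4
        = z / (of_nat (2 * n + 1) ^ 2 - z ^ 2)"
      unfolding N_def[symmetric] e f inverse_divide diff_frac_eq[OF N] by simp
  qed
  also have "(Digamma (1 - w) - Digamma w) / 4 = of_real pi / 4 * tan (of_real pi * z / 2)"
  proof -
    have "of_real pi * w = of_real pi / 2 - of_real pi * z / 2" by (simp add: w_def field_simps)
    then have "cot (of_real pi * w) = tan (of_real pi * z / 2)"
      by (simp add: cot_def tan_def sin_diff cos_diff flip: of_real_divide sin_of_real cos_of_real)
    then show ?thesis by (simp add: Digamma_reflection_complex[OF w])
  qed
  finally show ?thesis .
qed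

section \<open>The series over the odd integers\<close>

text \<open>The Dirichlet lambda function, for \<open>s \<ge> 2\<close> equal to
  \<open>(1 - 2 ^ (- s)) zeta(s)\<close>.\<close>

definition odd_zeta :: "nat \<Rightarrow> real" where
  "odd_zeta s = (\<Sum>n. 1 / real (2 * n + 1) ^ s)"

lemma odd_zeta_sums:
  assumes "s \<ge> 2"
  shows "(\<lambda>n. 1 / real (2 * n + 1) ^ s) sums odd_zeta s"
proof -
  have "summable (\<lambda>n. inverse (real (Suc n) ^ 2))"
    using inverse_power_summable[of 2, where 'a=real] by (subst summable_Suc_iff) auto
  then have "summable (\<lambda>n. 1 / real (2 * n + 1) ^ s)"
  proof (rule summable_comparison_test'[where N = 0])
    fix n :: nat
    have "real (Suc n) ^ 2 \<le> real (2 * n + 1) ^ 2" by (intro power_mono) auto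
    also have "\<dots> \<le> real (2 * n + 1) ^ s" using assms by (intro power_increasing) auto
    finally show "norm (1 / real (2 * n + 1) ^ s) \<le> inverse (real (Suc n) ^ 2)"
      by (simp add: inverse_eq_divide frac_le del: of_nat_Suc)
  qed
  then show ?thesis by (simp add: odd_zeta_def summable_sums)
qed

text \<open>Each partial fraction of the tangent is a geometric series in
  \<open>(z / N n) ^ 2\<close>, and the two summations are exchanged. Truncating at \<open>J\<close>
  makes the exchange finite; the error is bounded explicitly and tends to 0.\<close>

lemma odd_zeta_power_series:
  fixes z :: complex
  assumes "cmod z < 1"
  shows "(\<lambda>j. of_real (odd_zeta (2 * j + 2)) * z ^ (2 * j + 1)) sums
           (of_real pi / 4 * tan (of_real pi * z / 2))"
proof -
  define f where "f = of_real pi / 4 * tan (of_real pi * z / 2)"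
  define N :: "nat \<Rightarrow> complex" where "N n = of_nat (2 * n + 1)" for n
  define r where "r = cmod z"
  have f: "(\<lambda>n. z / (N n ^ 2 - z ^ 2)) sums f"
    using tan_partial_fractions[OF assms] by (simp add: f_def N_def)
  have r: "0 \<le> r" "r < 1" using assms by (auto simp: r_def)
  have nN: "cmod (N n) = real (2 * n + 1)" for n unfolding N_def norm_of_nat ..
  have N0: "N n \<noteq> 0" for n using nN[of n] by auto
  have Nz: "N n ^ 2 - z ^ 2 \<noteq> 0" for n
    using odd_plus_minus_nonzero[OF assms, of n]
    by (simp add: N_def power2_eq_square square_diff_square_factored)
  \<comment> \<open>A finite geometric sum in closed form: the second factor is what truncation at
    \<open>J\<close> leaves.\<close>
  have partial: "(\<lambda>n. z / (N n ^ 2 - z ^ 2) * (1 - (z / N n) ^ (2 * J))) sums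
      (\<Sum>j<J. of_real (odd_zeta (2 * j + 2)) * z ^ (2 * j + 1))" for J
  proof -
    have "(\<lambda>n. \<Sum>j<J. of_real (1 / real (2 * n + 1) ^ (2 * j + 2)) * z ^ (2 * j + 1)) sums
      (\<Sum>j<J. of_real (odd_zeta (2 * j + 2)) * z ^ (2 * j + 1))"
      by (intro sums_sum sums_mult2 sums_of_real odd_zeta_sums) auto
    also have "(\<lambda>n. \<Sum>j<J. of_real (1 / real (2 * n + 1) ^ (2 * j + 2)) * z ^ (2 * j + 1)) =
      (\<lambda>n. z / (N n ^ 2 - z ^ 2) * (1 - (z / N n) ^ (2 * J)))"
    proof
      fix n
      have q: "(z / N n) ^ 2 \<noteq> 1" using Nz[of n] N0[of n] by (auto simp: power_divide)
      have "(\<Sum>j<J. of_real (1 / real (2 * n + 1) ^ (2 * j + 2)) * z ^ (2 * j + 1))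
          = (\<Sum>j<J. z / N n ^ 2 * ((z / N n) ^ 2) ^ j)"
      proof (rule sum.cong)
        fix j
        have "of_real (1 / real (2 * n + 1) ^ (2 * j + 2)) = 1 / N n ^ (2 * j + 2)"
          by (simp add: N_def)
        moreover have "1 / N n ^ (2 * j + 2) * z ^ (2 * j + 1) = z / N n ^ 2 * ((z / N n) ^ 2) ^ j"
          by (simp add: power_divide power_add power_mult power2_eq_square power_mult_distrib)
        ultimately show "of_real (1 / real (2 * n + 1) ^ (2 * j + 2)) * z ^ (2 * j + 1)
            = z / N n ^ 2 * ((z / N n) ^ 2) ^ j" by simp
      qed simp
      also have "\<dots> = z / N n ^ 2 * ((1 - ((z / N n) ^ 2) ^ J) / (1 - (z / N n) ^ 2))"
        unfolding sum_distrib_left[symmetric] using q by (simp add: sum_gp_strict)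
      also have "\<dots> = z / (N n ^ 2 - z ^ 2) * (1 - (z / N n) ^ (2 * J))"
      proof -
        have "N n ^ 2 - z ^ 2 = N n ^ 2 * (1 - (z / N n) ^ 2)"
          using N0[of n] by (simp add: power_divide right_diff_distrib)
        then show ?thesis by (simp add: power_mult)
      qed
      finally show "(\<Sum>j<J. of_real (1 / real (2 * n + 1) ^ (2 * j + 2)) * z ^ (2 * j + 1)) = \<dots>" .
    qed
    finally show ?thesis .
  qed
  \<comment> \<open>Since \<open>x \<ge> 1\<close>, the denominator is at least
    \<open>x ^ 2 - r ^ 2 \<ge> (1 - r ^ 2) * x ^ 2\<close>, which allows comparison with
    \<open>odd_zeta 2\<close>.\<close>
  have sumr: "summable (\<lambda>n. cmod (z / (N n ^ 2 - z ^ 2)))"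
  proof (rule summable_comparison_test'[where N = 0])
    show "summable (\<lambda>n. r / (1 - r ^ 2) * (1 / real (2 * n + 1) ^ 2))"
      by (intro summable_mult sums_summable[OF odd_zeta_sums]) auto
    fix n :: nat
    define x where "x = real (2 * n + 1)"
    have x: "x \<ge> 1" by (simp add: x_def)
    have r2: "r ^ 2 < 1" using r by (simp add: power_less_one_iff abs_square_less_1)
    have x2: "x ^ 2 \<ge> 1" using x by simp
    have "r ^ 2 * 1 \<le> r ^ 2 * x ^ 2" using x2 by (intro mult_left_mono) auto
    then have "(1 - r ^ 2) * x ^ 2 \<le> x ^ 2 - r ^ 2" by (simp add: algebra_simps)
    also have "\<dots> \<le> cmod (N n ^ 2 - z ^ 2)"
      using norm_triangle_ineq2[of "N n ^ 2" "z ^ 2"] by (simp add: norm_power nN r_def x_def)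
    finally have le: "(1 - r ^ 2) * x ^ 2 \<le> cmod (N n ^ 2 - z ^ 2)" .
    have "0 < (1 - r ^ 2) * x ^ 2" using r2 x2 by (intro mult_pos_pos) linarith+
    then have "r / cmod (N n ^ 2 - z ^ 2) \<le> r / ((1 - r ^ 2) * x ^ 2)"
      using le r by (intro frac_le) auto
    then show "norm (cmod (z / (N n ^ 2 - z ^ 2))) \<le> r / (1 - r ^ 2) * (1 / real (2 * n + 1) ^ 2)"
      by (simp add: norm_divide r_def x_def)
  qed
  define S where "S = (\<Sum>n. cmod (z / (N n ^ 2 - z ^ 2)))"
  \<comment> \<open>Because \<open>cmod (N n) \<ge> 1\<close>, the remainder factor
    \<open>(z / N n) ^ (2 * J)\<close> is at most \<open>r ^ (2 * J)\<close>, uniformly in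
    \<open>n\<close>.\<close>
  have bound: "cmod ((\<Sum>j<J. of_real (odd_zeta (2 * j + 2)) * z ^ (2 * j + 1)) - f) \<le> (r ^ 2) ^ J * S" for J
  proof -
    have d: "(\<lambda>n. z / (N n ^ 2 - z ^ 2) * (z / N n) ^ (2 * J)) sums
        (f - (\<Sum>j<J. of_real (odd_zeta (2 * j + 2)) * z ^ (2 * j + 1)))"
      using sums_diff[OF f partial[of J]] by (simp add: right_diff_distrib)
    have le: "cmod (z / (N n ^ 2 - z ^ 2) * (z / N n) ^ (2 * J)) \<le>
        (r ^ 2) ^ J * cmod (z / (N n ^ 2 - z ^ 2))" for n
    proof -
      have "r / real (2 * n + 1) \<le> r / 1" using r by (intro divide_left_mono) auto
      then have "cmod (z / N n) \<le> r" by (simp add: norm_divide r_def nN)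
      then have "cmod (z / N n) ^ (2 * J) \<le> r ^ (2 * J)" by (intro power_mono) auto
      then have "cmod (z / (N n ^ 2 - z ^ 2)) * cmod (z / N n) ^ (2 * J)
          \<le> cmod (z / (N n ^ 2 - z ^ 2)) * r ^ (2 * J)" by (intro mult_left_mono) auto
      then show ?thesis
        unfolding norm_mult[of _ "(z / N n) ^ (2 * J)"] norm_power
        by (simp only: power_mult[symmetric] mult.commute[of "r ^ (2 * J)"])
    qed
    have "cmod (f - (\<Sum>j<J. of_real (odd_zeta (2 * j + 2)) * z ^ (2 * j + 1))) \<le>
        (\<Sum>n. (r ^ 2) ^ J * cmod (z / (N n ^ 2 - z ^ 2)))"
      unfolding sums_unique[OF d] using le by (intro norm_suminf_le summable_mult sumr) auto
    also have "\<dots> = (r ^ 2) ^ J * S" unfolding S_def using sumr by (rule suminf_mult)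
    finally show ?thesis by (simp add: norm_minus_commute)
  qed
  have lim: "(\<lambda>J. (r ^ 2) ^ J * S) \<longlonglongrightarrow> 0 * S"
    using r by (intro tendsto_mult tendsto_const LIMSEQ_power_zero) (auto simp: abs_square_less_1)
  have "(\<lambda>J. (\<Sum>j<J. of_real (odd_zeta (2 * j + 2)) * z ^ (2 * j + 1)) - f) \<longlonglongrightarrow> 0"
    by (rule Lim_null_comparison[OF always_eventually lim[simplified]]) (intro allI bound)
  then show ?thesis unfolding sums_def f_def by (rule LIM_zero_cancel)
qed

text \<open>Subtracting 1 drops the term \<open>n = 0\<close>. Summing over \<open>j\<close> first
  leaves, for each odd number from 3 on, a truncated geometric series below
  \<open>x / (1 - x) = 1 / ((2 n + 3) ^ 2 - 1)\<close>, and these bounds telescope.\<close>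

lemma sum_odd_zeta_minus_1_le: "(\<Sum>j=1..K. odd_zeta (2 * j) - 1) \<le> 1 / 4"
proof -
  have lhs: "(\<lambda>n. \<Sum>j=1..K. 1 / real (2 * Suc n + 1) ^ (2 * j)) sums (\<Sum>j=1..K. odd_zeta (2 * j) - 1)"
  proof (rule sums_sum)
    fix j assume "j \<in> {1..K}"
    then have "(\<lambda>n. 1 / real (2 * n + 1) ^ (2 * j)) sums odd_zeta (2 * j)"
      by (intro odd_zeta_sums) auto
    then show "(\<lambda>n. 1 / real (2 * Suc n + 1) ^ (2 * j)) sums (odd_zeta (2 * j) - 1)"
      by (subst sums_Suc_iff) auto
  qed
  have rhs: "(\<lambda>n. 1 / 4 * (1 / real (Suc n) - 1 / real (Suc (Suc n)))) sums (1 / 4 * (1 - 0))"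
  proof (intro sums_mult)
    have "(\<lambda>n. 1 / real (Suc n)) \<longlonglongrightarrow> 0" by (rule LIMSEQ_Suc[OF lim_1_over_n])
    from telescope_sums'[OF this]
    show "(\<lambda>n. 1 / real (Suc n) - 1 / real (Suc (Suc n))) sums (1 - 0)" by simp
  qed
  have le: "(\<Sum>j=1..K. 1 / real (2 * Suc n + 1) ^ (2 * j))
      \<le> 1 / 4 * (1 / real (Suc n) - 1 / real (Suc (Suc n)))" for n
  proof -
    define x where "x = 1 / real (2 * Suc n + 1) ^ 2"
    have gt1: "real (2 * Suc n + 1) ^ 2 > 1" by (intro one_less_power) auto
    then have x: "0 < x" "x < 1" by (auto simp: x_def)
    have "(\<Sum>j=1..K. 1 / real (2 * Suc n + 1) ^ (2 * j)) = (\<Sum>j=1..K. x ^ j)"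
      by (simp add: x_def power_mult power_divide)
    also have "\<dots> = x * (\<Sum>j<K. x ^ j)"
      by (simp add: sum_distrib_left sum.atLeast1_atMost_eq)
    also have "\<dots> = x * ((1 - x ^ K) / (1 - x))" using x by (simp add: sum_gp_strict)
    also have "\<dots> \<le> x * (1 / (1 - x))" using x by (intro mult_left_mono divide_right_mono) auto
    also have "\<dots> = 1 / (real (2 * Suc n + 1) ^ 2 - 1)"
      using gt1 by (simp add: x_def field_simps)
    also have "real (2 * Suc n + 1) ^ 2 - 1 = 4 * (real (Suc n) * real (Suc (Suc n)))"
      by (simp add: power2_eq_square algebra_simps)
    also have "1 / \<dots> = 1 / 4 * (1 / real (Suc n) - 1 / real (Suc (Suc n)))"
      by (simp add: field_simps)
    finally show ?thesis .
  qed
  show ?thesis using sums_le[OF le lhs rhs] by simp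
qed

lemma odd_zeta_ge_1:
  assumes "s \<ge> 2"
  shows "odd_zeta s \<ge> 1"
  using sum_le_suminf[OF sums_summable[OF odd_zeta_sums[OF assms]], of "{0}"]
  by (simp add: odd_zeta_def)

section \<open>Bernoulli numbers as values of \<open>odd_zeta\<close>\<close>

text \<open>With \<open>b(t) = t / (exp t - 1)\<close>, the coefficients are those of
  \<open>b(2 t) - b(t)\<close>. Over the common denominator
  \<open>exp (2 t) - 1 = (exp t - 1) (exp t + 1)\<close> this difference collapses to
  \<open>- t / (exp t + 1)\<close>.\<close>

lemma bernoulli_scaled_generating_function:
  "Abs_fps (\<lambda>n. (2 ^ n - 1) * bernoulli n / fact n) * (fps_exp 1 + 1) = - fps_X"
proof -
  define E :: "real fps" where "E = fps_exp 1"
  define b where "b = Abs_fps (\<lambda>n. bernoulli n / fact n)"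
  define b2 where "b2 = b oo (fps_const 2 * fps_X)"
  have b: "b * (E - 1) = fps_X"
    unfolding b_def E_def by (rule bernoulli_generating_function)
  have "(E - 1) oo (fps_const 2 * fps_X) = E * E - 1"
    by (simp add: E_def fps_compose_sub_distrib flip: fps_exp_add_mult)
  moreover have "fps_X oo (fps_const 2 * fps_X) = (fps_const 2 * fps_X :: real fps)" by simp
  ultimately have b2: "b2 * (E * E - 1) = fps_const 2 * fps_X"
    using arg_cong[OF b, of "\<lambda>f. f oo (fps_const 2 * fps_X)"]
    by (simp add: fps_compose_mult_distrib b2_def)
  have "((b2 - b) * (E + 1)) * (E - 1) = b2 * (E * E - 1) - b * (E - 1) * (E + 1)"
    by (simp add: algebra_simps)
  also have "\<dots> = fps_const 2 * fps_X - fps_X * (E + 1)" by (simp only: b b2)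
  also have "\<dots> = (- fps_X) * (E - 1)"
    by (simp add: algebra_simps flip: numeral_fps_const)
  finally have "((b2 - b) * (E + 1)) * (E - 1) = (- fps_X) * (E - 1)" .
  moreover have "E - 1 \<noteq> 0" using b by auto
  ultimately have "(b2 - b) * (E + 1) = - fps_X" using mult_right_cancel by blast
  moreover have "b2 - b = Abs_fps (\<lambda>n. (2 ^ n - 1) * bernoulli n / fact n)"
    by (simp add: b2_def b_def fps_compose_linear fps_eq_iff left_diff_distrib diff_divide_distrib)
  ultimately show ?thesis by (simp add: E_def)
qed

lemma has_fps_expansion_unique:
  fixes f :: "complex \<Rightarrow> complex"
  assumes "f has_fps_expansion F" "f has_fps_expansion G"
  shows "F = G"
  using fps_nth_fps_expansion[OF assms(1)] fps_nth_fps_expansion[OF assms(2)]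
  by (simp add: fps_eq_iff)

text \<open>Both sides are the coefficients of \<open>- t / (exp t + 1)\<close> at \<open>t = \<i> pi z\<close>, which equals
  \<open>- t / 2 - pi z / 2 * tan (pi z / 2)\<close>.\<close>

lemma bernoulli_eq_odd_zeta:
  assumes "j \<ge> 1"
  shows "(2 ^ (2 * j) - 1) * bernoulli (2 * j) / fact (2 * j) * pi ^ (2 * j)
           = - 2 * (-1) ^ j * odd_zeta (2 * j)"
proof -
  define c :: complex where "c = \<i> * of_real pi"
  define g where "g n = (2 ^ n - 1) * bernoulli n / fact n" for n
  \<comment> \<open>\<open>A\<close> is the Bernoulli side and \<open>B\<close> the tangent side of
    the expansion; the entry \<open>- c / 2\<close> of \<open>B\<close> in degree 1 comes from the
    summand \<open>- t / 2\<close>.\<close>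
  define A where "A = Abs_fps (\<lambda>n. of_real (g n) * c ^ n)"
  define B where "B = Abs_fps (\<lambda>n. if even n \<and> n > 0 then - 2 * complex_of_real (odd_zeta n)
                        else if n = 1 then - c / 2 else 0)"
  define h where "h z = - (c * z / 2) - of_real pi * z / 2 * tan (of_real pi * z / 2)" for z :: complex
  have A: "A * (fps_exp c + 1) = - fps_const c * fps_X"
  proof (rule fps_ext)
    fix n
    \<comment> \<open>The coefficients of \<open>exp t + 1\<close>. Replacing \<open>t\<close> by
      \<open>c z\<close> multiplies the whole Cauchy product in degree \<open>n\<close> by
      \<open>c ^ n\<close>.\<close>
    define e :: "nat \<Rightarrow> real" where "e i = 1 / fact i + (if i = 0 then 1 else 0)" for i
    have "fps_nth (Abs_fps g * (fps_exp 1 + 1)) n = (\<Sum>i=0..n. g i * e (n - i))"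
      by (simp add: fps_mult_nth e_def)
    then have g: "(\<Sum>i=0..n. g i * e (n - i)) = - (if n = 1 then 1 else 0)"
      using bernoulli_scaled_generating_function[folded g_def] by simp
    have "fps_nth (A * (fps_exp c + 1)) n = (\<Sum>i=0..n. c ^ n * of_real (g i * e (n - i)))"
      unfolding fps_mult_nth
    proof (rule sum.cong)
      fix i assume "i \<in> {0..n}"
      then have n: "c ^ n = c ^ i * c ^ (n - i)" by (simp flip: power_add)
      show "fps_nth A i * fps_nth (fps_exp c + 1) (n - i) = c ^ n * of_real (g i * e (n - i))"
        unfolding n by (simp add: A_def e_def algebra_simps)
    qed simp
    also have "\<dots> = c ^ n * of_real (\<Sum>i=0..n. g i * e (n - i))" by (simp add: sum_distrib_left)
    also have "\<dots> = fps_nth (- fps_const c * fps_X) n" unfolding g by (cases "n = 1") auto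
    finally show "fps_nth (A * (fps_exp c + 1)) n = fps_nth (- fps_const c * fps_X) n" .
  qed
  have "(\<lambda>n. fps_nth B n * z ^ n) sums h z" if "cmod z < 1" for z
  proof -
    define u where "u n = (if even n \<and> n > 0 then - 2 * complex_of_real (odd_zeta n) * z ^ n else 0)" for n
    have "(\<lambda>j. u (2 * j + 2)) sums (- 2 * z * (of_real pi / 4 * tan (of_real pi * z / 2)))"
      using sums_mult[OF odd_zeta_power_series[OF that], of "- 2 * z"]
      by (simp add: u_def mult_ac)
    also have "?this \<longleftrightarrow> u sums (- 2 * z * (of_real pi / 4 * tan (of_real pi * z / 2)))"
    proof (rule sums_mono_reindex)
      show "strict_mono (\<lambda>j::nat. 2 * j + 2)" by (auto simp: strict_mono_def)
      fix n assume n: "n \<notin> range (\<lambda>j::nat. 2 * j + 2)"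
      have "\<not> (even n \<and> n > 0)"
      proof
        assume "even n \<and> n > 0"
        then have "n = 2 * (n div 2 - 1) + 2" by auto
        then show False using n by blast
      qed
      then show "u n = 0" by (simp only: u_def if_False)
    qed
    finally have u: "u sums (- 2 * z * (of_real pi / 4 * tan (of_real pi * z / 2)))" .
    have "(\<lambda>n. if n = 1 then - c / 2 * z ^ n else 0) sums (- c / 2 * z ^ 1)"
      by (rule sums_single)
    from sums_add[OF this u]
    have "(\<lambda>n. (if n = 1 then - c / 2 * z ^ n else 0) + u n) sums h z"
      by (simp add: h_def field_simps)
    also have "(\<lambda>n. (if n = 1 then - c / 2 * z ^ n else 0) + u n) = (\<lambda>n. fps_nth B n * z ^ n)"
      by (auto simp: B_def u_def)
    finally show ?thesis .
  qed
  then have "h has_fps_expansion B"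
    by (intro has_fps_expansionI eventually_nhds[THEN iffD2]) (auto intro!: exI[of _ "ball 0 1"])
  then have "(\<lambda>z. h z * (exp (c * z) + 1)) has_fps_expansion B * (fps_exp c + 1)"
    by (intro fps_expansion_intros)
  \<comment> \<open>Near 0 the factor \<open>exp (c * z) + 1\<close> is close to 2, hence nonzero;
    an identity there suffices to compare expansions.\<close>
  moreover have "eventually (\<lambda>z. h z * (exp (c * z) + 1) = - c * z) (nhds 0)"
  proof -
    have "((\<lambda>z. exp (c * z) + 1) \<longlongrightarrow> exp (c * 0) + 1) (nhds 0)"
      by (intro tendsto_intros filterlim_ident)
    then have "eventually (\<lambda>z. exp (c * z) + 1 \<noteq> 0) (nhds 0)"
      by (rule tendsto_imp_eventually_ne) simp
    then show ?thesis
    proof eventually_elim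
      case (elim z)
      define e where "e = exp (\<i> * (of_real pi * z / 2))"
      have e0: "e \<noteq> 0" by (simp add: e_def)
      have "c * z = \<i> * (of_real pi * z / 2) + \<i> * (of_real pi * z / 2)"
        by (simp add: c_def algebra_simps)
      then have ee: "exp (c * z) = e ^ 2" by (simp only: exp_add e_def power2_eq_square)
      have inv: "exp (- (\<i> * (of_real pi * z / 2))) = 1 / e"
        by (simp add: e_def exp_minus inverse_eq_divide)
      \<comment> \<open>In these terms \<open>tan (pi z / 2)\<close> is
        \<open>- i (e ^ 2 - 1) / (e ^ 2 + 1)\<close>, so \<open>D - 2\<close> is the numerator and
        \<open>D\<close> the factor to be cleared.\<close>
      define D where "D = e ^ 2 + 1"
      have D0: "D \<noteq> 0" using elim by (simp add: D_def ee)
      have "e - 1 / e = (D - 2) / e" "e + 1 / e = D / e"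
        using e0 by (simp_all add: D_def field_simps power2_eq_square)
      then have "tan (of_real pi * z / 2) = ((D - 2) / e / (2 * \<i>)) / (D / e / 2)"
        unfolding tan_def sin_exp_eq cos_exp_eq e_def[symmetric] inv by simp
      also have "\<dots> = - \<i> * (D - 2) / D"
        using e0 D0 by (simp add: field_simps)
      finally have tan: "tan (of_real pi * z / 2) * D = - \<i> * (D - 2)" using D0 by simp
      have "h z * D = - (c * z / 2) * D - of_real pi * z / 2 * (tan (of_real pi * z / 2) * D)"
        by (simp add: h_def algebra_simps)
      also have "\<dots> = - (c * z / 2) * D - of_real pi * z / 2 * (- \<i> * (D - 2))"
        by (simp only: tan)
      also have "\<dots> = - c * z" by (simp add: c_def algebra_simps)
      finally show ?case by (simp only: D_def ee)
    qed
  qed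
  ultimately have "(\<lambda>z. - c * z) has_fps_expansion B * (fps_exp c + 1)"
    unfolding has_fps_expansion_def by (auto elim: eventually_elim2)
  moreover have "(\<lambda>z. - c * z) has_fps_expansion fps_const (- c) * fps_X"
    by (intro fps_expansion_intros)
  ultimately have "B * (fps_exp c + 1) = fps_const (- c) * fps_X"
    by (rule has_fps_expansion_unique)
  also have "\<dots> = A * (fps_exp c + 1)" by (simp add: A)
  finally have "B = A"
  proof (rule mult_right_cancel[THEN iffD1, rotated])
    show "fps_exp c + 1 \<noteq> 0"
    proof
      assume "fps_exp c + 1 = 0"
      then have "fps_nth (fps_exp c + 1) 0 = 0" by simp
      then show False by simp
    qed
  qed
  then have "fps_nth A (2 * j) = fps_nth B (2 * j)" by simp
  then have "of_real (g (2 * j)) * c ^ (2 * j) = - 2 * complex_of_real (odd_zeta (2 * j))"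
    using assms by (simp add: A_def B_def)
  also have "c ^ (2 * j) = of_real ((-1) ^ j * pi ^ (2 * j))"
    by (simp add: c_def power_mult_distrib power_mult power_minus[of "(of_real pi)\<^sup>2"])
  finally have "complex_of_real (g (2 * j) * ((-1) ^ j * pi ^ (2 * j))) = of_real (- 2 * odd_zeta (2 * j))"
    by simp
  then have "g (2 * j) * ((-1) ^ j * pi ^ (2 * j)) = - 2 * odd_zeta (2 * j)"
    by (simp only: of_real_eq_iff)
  \<comment> \<open>The sign is its own inverse, so multiplying by it moves it to the other
    side.\<close>
  then have "(-1) ^ j * (g (2 * j) * ((-1) ^ j * pi ^ (2 * j))) = (-1) ^ j * (- 2 * odd_zeta (2 * j))"
    by simp
  then have "g (2 * j) * pi ^ (2 * j) * ((-1) ^ j * (-1) ^ j) = - 2 * (-1) ^ j * odd_zeta (2 * j)"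
    by (simp add: mult_ac)
  moreover have "(-1) ^ j * (-1) ^ j = (1::real)" by (simp flip: power_mult_distrib)
  ultimately show ?thesis by (simp add: g_def)
qed

section \<open>Roots of palindromic polynomials on the unit circle\<close>

text \<open>The Dirichlet kernel: doubled, each product is a difference of sines at consecutive
  \<open>j\<close>, so the sum telescopes, and its two end terms are negatives of each
  other.\<close>

lemma sin_times_sum_cos:
  fixes t :: real
  shows "sin t * (\<Sum>j\<le>m. cos ((real m - 2 * real j) * t)) = sin (real (m + 1) * t)"
proof -
  define s where "s j = sin ((real m + 1 - 2 * real j) * t)" for j
  have "2 * (sin t * cos ((real m - 2 * real j) * t)) = s j - s (Suc j)" for j
  proof -
    have "(real m + 1 - 2 * real j) * t = (real m - 2 * real j) * t + t"
      "(real m + 1 - 2 * real (Suc j)) * t = (real m - 2 * real j) * t - t"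
      by (simp_all add: algebra_simps)
    then show ?thesis unfolding s_def by (simp add: sin_add sin_diff)
  qed
  then have "2 * (sin t * (\<Sum>j\<le>m. cos ((real m - 2 * real j) * t))) = (\<Sum>j\<le>m. s j - s (Suc j))"
    by (simp add: sum_distrib_left)
  also have "\<dots> = s 0 - s (Suc m)" by (rule sum_telescope)
  also have "s (Suc m) = sin (- (real (m + 1) * t))"
    unfolding s_def by (rule arg_cong[where f = sin]) (simp add: algebra_simps)
  finally show ?thesis by (simp add: s_def add.commute)
qed

text \<open>Taking out the middle power \<open>cis (m t)\<close> centres the exponents at 0.
  Reversing the index then conjugates the remaining sum, which is thus real and equal to its cosine
  part.\<close>

lemma palindromic_sum_cis:
  fixes a :: "nat \<Rightarrow> real"
  assumes "\<And>j. j \<le> m \<Longrightarrow> a (m - j) = a j"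
  shows "(\<Sum>j\<le>m. of_real (a j) * cis (2 * t) ^ j) =
           cis (real m * t) * of_real (\<Sum>j\<le>m. a j * cos ((real m - 2 * real j) * t))"
proof -
  define T where "T = (\<Sum>j\<le>m. of_real (a j) * cis ((2 * real j - real m) * t))"
  have "(\<Sum>j\<le>m. of_real (a j) * cis (2 * t) ^ j) = cis (real m * t) * T"
  proof -
    have "cis (2 * t) ^ j = cis (real m * t) * cis ((2 * real j - real m) * t)" for j
      unfolding Complex.DeMoivre cis_mult by (rule arg_cong[where f = cis]) (simp add: algebra_simps)
    then show ?thesis by (simp add: T_def sum_distrib_left mult_ac)
  qed
  moreover have "T = of_real (\<Sum>j\<le>m. a j * cos ((real m - 2 * real j) * t))"
  proof -
    have "T = (\<Sum>j\<le>m. of_real (a (m - j)) * cis ((2 * real (m - j) - real m) * t))"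
      unfolding T_def by (rule sum.reindex_bij_witness[of _ "\<lambda>j. m - j" "\<lambda>j. m - j"]) auto
    also have "\<dots> = (\<Sum>j\<le>m. of_real (a j) * cis ((real m - 2 * real j) * t))"
      using assms by (intro sum.cong refl) (auto simp: of_nat_diff)
    finally have T2: "T = (\<Sum>j\<le>m. of_real (a j) * cis ((real m - 2 * real j) * t))" .
    have "cis ((real m - 2 * real j) * t) = cnj (cis ((2 * real j - real m) * t))" for j
      unfolding cis_cnj by (simp add: left_diff_distrib)
    then have "T = cnj T" unfolding T2 by (subst (2) T2[symmetric]) (simp add: T_def)
    then have "Im T = 0" by (metis complex_cnj_complex_of_real complex_is_Real_iff Reals_cnj_iff)
    moreover have "Re T = (\<Sum>j\<le>m. a j * cos ((real m - 2 * real j) * t))"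
      unfolding T2 by simp
    ultimately show ?thesis by (simp add: complex_eq_iff)
  qed
  ultimately show ?thesis by simp
qed

text \<open>On the unit circle the polynomial is, up to a unimodular factor, a real trigonometric
  polynomial whose product with \<open>sin t\<close> differs from \<open>sin ((m + 1) t)\<close> by less than \<open>1\<close>,
  so it changes sign between consecutive extrema of \<open>sin ((m + 1) t)\<close>.\<close>

lemma palindromic_near_geometric_roots:
  fixes a :: "nat \<Rightarrow> real"
  assumes sym: "\<And>j. j \<le> m \<Longrightarrow> a (m - j) = a j"
    and close: "(\<Sum>j\<le>m. \<bar>a j - 1\<bar>) < 1"
  shows "\<exists>R. finite R \<and> card R = m \<and>
           (\<forall>z\<in>R. cmod z = 1 \<and> (\<Sum>j\<le>m. of_real (a j) * z ^ j) = 0)"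
proof -
  define T where "T t = (\<Sum>j\<le>m. a j * cos ((real m - 2 * real j) * t))" for t
  \<comment> \<open>The points of the open interval from 0 to \<open>pi\<close> where
    \<open>sin ((m + 1) t)\<close> is extremal, with value \<open>(-1) ^ l\<close>. The indices
    \<open>l \<le> m\<close> give \<open>m + 1\<close> points and hence \<open>m\<close>
    gaps.\<close>
  define \<theta> where "\<theta> l = (2 * real l + 1) * pi / (2 * real (m + 1))" for l
  have mono: "\<theta> l < \<theta> l'" if "l < l'" for l l'
    using that by (simp add: \<theta>_def divide_strict_right_mono)
  have range: "0 < \<theta> l" "\<theta> l < pi" if "l \<le> m" for l
  proof -
    show "0 < \<theta> l" by (simp add: \<theta>_def)
    have "(2 * real l + 1) * pi < (2 * real (m + 1)) * pi" using that by simp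
    then show "\<theta> l < pi" by (simp add: \<theta>_def pos_divide_less_eq mult.commute)
  qed
  have sign: "(-1) ^ l * T (\<theta> l) > 0" if "l \<le> m" for l
  proof -
    define E where "E = (\<Sum>j\<le>m. (a j - 1) * cos ((real m - 2 * real j) * \<theta> l))"
    have pos: "sin (\<theta> l) > 0" using range[OF that] by (intro sin_gt_zero)
    have "\<bar>E\<bar> \<le> (\<Sum>j\<le>m. \<bar>(a j - 1) * cos ((real m - 2 * real j) * \<theta> l)\<bar>)"
      unfolding E_def by (rule sum_abs)
    also have "\<dots> \<le> (\<Sum>j\<le>m. \<bar>a j - 1\<bar>)"
      by (intro sum_mono) (simp add: abs_mult mult_left_le)
    finally have E: "\<bar>E\<bar> < 1" using close by linarith
    have "\<bar>(-1) ^ l * (sin (\<theta> l) * E)\<bar> \<le> \<bar>E\<bar>"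
      by (simp add: abs_mult power_abs mult_left_le_one_le)
    then have small: "\<bar>(-1) ^ l * (sin (\<theta> l) * E)\<bar> < 1" using E by linarith
    have "real (m + 1) * \<theta> l = pi / 2 + real l * pi" by (simp add: \<theta>_def field_simps)
    then have "sin (real (m + 1) * \<theta> l) = (-1) ^ l"
      by (simp only: sin_add) (simp add: cos_npi)
    then have "sin (\<theta> l) * T (\<theta> l) = (-1) ^ l + sin (\<theta> l) * E"
      using sin_times_sum_cos[of "\<theta> l" m]
      by (simp add: T_def E_def left_diff_distrib sum_subtractf right_diff_distrib)
    then have "sin (\<theta> l) * ((-1) ^ l * T (\<theta> l)) = (-1) ^ l * ((-1) ^ l + sin (\<theta> l) * E)"
      by (simp add: mult.left_commute)
    also have "\<dots> = 1 + (-1) ^ l * (sin (\<theta> l) * E)"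
      by (simp add: distrib_left flip: power_mult_distrib)
    also have "\<dots> > 0" using small by linarith
    finally show ?thesis using pos by (simp add: zero_less_mult_iff)
  qed
  have cont: "continuous_on A T" for A
    unfolding T_def by (intro continuous_intros)
  \<comment> \<open>Strict inequalities keep the zeros of neighbouring gaps apart.\<close>
  have "\<exists>x. \<theta> l < x \<and> x < \<theta> (Suc l) \<and> T x = 0" if "l < m" for l
  proof -
    define g where "g x = (-1) ^ l * T x" for x
    have s: "g (\<theta> l) > 0" "g (\<theta> (Suc l)) < 0"
      using sign[of l] sign[of "Suc l"] that by (auto simp: g_def)
    have "\<exists>x. \<theta> l \<le> x \<and> x \<le> \<theta> (Suc l) \<and> g x = 0"
      using s mono[of l "Suc l"] unfolding g_def
      by (intro IVT2') (auto intro!: continuous_intros cont)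
    then obtain x where x: "\<theta> l \<le> x" "x \<le> \<theta> (Suc l)" "g x = 0" by blast
    then have "x \<noteq> \<theta> l" "x \<noteq> \<theta> (Suc l)" using s by auto
    then show ?thesis using x by (intro exI[of _ x]) (auto simp: g_def)
  qed
  then obtain x where x: "\<And>l. l < m \<Longrightarrow> \<theta> l < x l \<and> x l < \<theta> (Suc l) \<and> T (x l) = 0"
    by metis
  have x_less: "x l < x l'" if "l < l'" "l' < m" for l l'
  proof -
    have "\<theta> (Suc l) \<le> \<theta> l'" using mono[of "Suc l" l'] that by (cases "Suc l = l'") auto
    then show ?thesis using x[of l] x[of l'] that by force
  qed
  have x_range: "0 < x l" "x l < pi" if "l < m" for l
    using x[OF that] range[of l] range[of "Suc l"] that by force+
  \<comment> \<open>Zeros stay below \<open>pi\<close>, so their doubled angles remain within one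
    turn of the circle.\<close>
  have inj_cis: "cis (2 * u) \<noteq> cis (2 * v)" if "0 < u" "u < v" "v < pi" for u v
  proof
    assume "cis (2 * u) = cis (2 * v)"
    then have "cis (2 * v) / cis (2 * u) = 1" by simp
    then have "cis (2 * (v - u)) = 1" by (simp add: cis_divide right_diff_distrib)
    then have "cos (2 * (v - u)) = 1" by (simp add: complex_eq_iff)
    then have "sin (v - u) = 0" unfolding cos_double_sin by simp
    moreover have "sin (v - u) > 0" using that by (intro sin_gt_zero) auto
    ultimately show False by simp
  qed
  have inj: "inj_on (\<lambda>l. cis (2 * x l)) {..<m}"
  proof (rule linorder_inj_onI)
    fix l l' assume "l < l'" "l \<in> {..<m}" "l' \<in> {..<m}"
    then show "cis (2 * x l) \<noteq> cis (2 * x l')"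
      using x_less x_range by (intro inj_cis) auto
  qed auto
  show ?thesis
  proof (intro exI[of _ "(\<lambda>l. cis (2 * x l)) ` {..<m}"] conjI ballI)
    show "card ((\<lambda>l. cis (2 * x l)) ` {..<m}) = m" using card_image[OF inj] by simp
  next
    fix z assume "z \<in> (\<lambda>l. cis (2 * x l)) ` {..<m}"
    then obtain l where l: "l < m" "z = cis (2 * x l)" by auto
    show "cmod z = 1" by (simp add: l)
    show "(\<Sum>j\<le>m. of_real (a j) * z ^ j) = 0"
      unfolding l(2) using palindromic_sum_cis[of m a "x l"] x[OF l(1)] sym
      by (simp add: T_def del: of_real_sum)
  qed auto
qed

text \<open>As many distinct roots as the degree leave room for no further root, and the orders,
  each at least 1, sum to at most the degree, so none exceeds 1.\<close>

lemma order_eq_1_if_card_roots: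
  fixes p :: "'a::idom poly"
  assumes "p \<noteq> 0" "R \<subseteq> {x. poly p x = 0}" "card R = degree p"
  shows "{x. poly p x = 0} = R" "\<And>x. poly p x = 0 \<Longrightarrow> order x p = 1"
proof -
  have fin: "finite {x. poly p x = 0}" using assms(1) by (rule poly_roots_finite)
  have le: "card {x. poly p x = 0} \<le> card R"
    using card_poly_roots_bound[OF assms(1)] assms(3) by simp
  then show eq: "{x. poly p x = 0} = R"
    using assms(2) card_seteq[OF fin] by blast
  fix x assume x: "poly p x = 0"
  have ge1: "order y p \<ge> 1" if "poly p y = 0" for y
    using that assms(1) by (simp add: order_root Suc_le_eq)
  show "order x p = 1"
  proof (rule ccontr)
    assume "order x p \<noteq> 1"
    then have "1 < order x p" using ge1[OF x] by simp
    then have "(\<Sum>y | poly p y = 0. 1) < (\<Sum>y | poly p y = 0. order y p)"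
      using fin ge1 x by (intro sum_strict_mono_ex1) auto
    also have "\<dots> \<le> degree p" by (rule sum_order_le_degree[OF assms(1)])
    finally show False using assms(3) by (simp add: eq)
  qed
qed

section \<open>The polynomial form of \<open>Y_k\<close> and its coefficients\<close>

text \<open>Adding the values at \<open>v\<close> and \<open>- v\<close> cancels the odd zeta part
  of \<open>P_k\<close> and doubles the even part. The scalings in \<open>Q_k\<close> give the
  factor \<open>2 ^ (2 k) + 1 - 2 ^ (2 k - 2 j) - 2 ^ (2 j)\<close>, which splits into the two
  factors of \<open>Y_poly\<close>; only the square \<open>- z\<close> of \<open>w\<close>
  enters.\<close>

lemma Y_k_eq_poly:
  assumes "k \<ge> 1"
  shows "Y_k k z = poly (Y_poly k) z"
proof -
  define w where "w = \<i> * csqrt z"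
  define c :: complex where "c = (2 * of_real pi) ^ (2 * k - 1) / fact (2 * k)"
  define b :: "nat \<Rightarrow> complex" where "b j = of_real (bernoulli (2 * j)) * of_real (bernoulli (2 * k - 2 * j)) *
                  of_nat ((2 * k) choose (2 * j))" for j
  define S where "S v = (\<Sum>j=0..k. (-1) ^ j * b j * v ^ (2 * j))" for v
  have P: "P_k k v + P_k k (- v) = 2 * c * S v" for v
  proof -
    define r where "r = zeta (of_nat (2 * k - 1)) * (v ^ (2 * k - 1) + (-1) ^ k * v)"
    have "odd (2 * k - 1)" using assms by simp
    then have "zeta (of_nat (2 * k - 1)) * ((- v) ^ (2 * k - 1) + (-1) ^ k * (- v)) = - r"
      by (simp add: r_def power_minus_odd algebra_simps)
    moreover have "(- v) ^ (2 * j) = v ^ (2 * j)" for j by simp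
    ultimately show ?thesis
      unfolding P_k_def r_def[symmetric] S_def c_def b_def by (simp add: mult.assoc)
  qed
  have "Q_k k w + Q_k k (- w) = (2 ^ (2 * k) + 1) * (P_k k w + P_k k (- w))
          - 2 ^ (2 * k) * (P_k k (w / 2) + P_k k (- (w / 2))) - (P_k k (2 * w) + P_k k (- (2 * w)))"
    by (simp add: Q_k_def algebra_simps)
  also have "\<dots> = 2 * c * ((2 ^ (2 * k) + 1) * S w - 2 ^ (2 * k) * S (w / 2) - S (2 * w))"
    unfolding P by (simp add: algebra_simps)
  also have "(2 ^ (2 * k) + 1) * S w - 2 ^ (2 * k) * S (w / 2) - S (2 * w) =
      (\<Sum>j=0..k. b j * (2 ^ (2 * j) - 1) * (2 ^ (2 * k - 2 * j) - 1) * z ^ j)"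
    unfolding S_def sum_distrib_left sum_subtractf[symmetric]
  proof (rule sum.cong)
    fix j assume "j \<in> {0..k}"
    then have split: "(2::complex) ^ (2 * k) = 2 ^ (2 * j) * 2 ^ (2 * k - 2 * j)"
      by (simp flip: power_add)
    have "w ^ (2 * j) = (-1) ^ j * z ^ j"
      by (simp add: w_def power_mult power_mult_distrib power_minus[of z])
    moreover have "(-1) ^ j * (-1) ^ j = (1::complex)"
      by (simp flip: power_mult_distrib)
    ultimately have wz: "(-1) ^ j * b j * w ^ (2 * j) = b j * z ^ j"
      by (metis mult.assoc mult.commute mult_1)
    have "(2 ^ (2 * k) + 1) * ((-1) ^ j * b j * w ^ (2 * j)) -
          2 ^ (2 * k) * ((-1) ^ j * b j * (w / 2) ^ (2 * j)) - (-1) ^ j * b j * (2 * w) ^ (2 * j)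
        = ((2 ^ (2 * k) + 1) - 2 ^ (2 * k) / 2 ^ (2 * j) - 2 ^ (2 * j)) *
            ((-1) ^ j * b j * w ^ (2 * j))"
      by (simp add: power_divide power_mult_distrib algebra_simps)
    also have "\<dots> = (2 ^ (2 * j) * 2 ^ (2 * k - 2 * j) + 1 - 2 ^ (2 * k - 2 * j) - 2 ^ (2 * j)) *
        (b j * z ^ j)"
      unfolding wz split by simp
    also have "\<dots> = b j * (2 ^ (2 * j) - 1) * (2 ^ (2 * k - 2 * j) - 1) * z ^ j"
      by (simp add: algebra_simps)
    finally show "(2 ^ (2 * k) + 1) * ((-1) ^ j * b j * w ^ (2 * j)) -
          2 ^ (2 * k) * ((-1) ^ j * b j * (w / 2) ^ (2 * j)) - (-1) ^ j * b j * (2 * w) ^ (2 * j)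
        = b j * (2 ^ (2 * j) - 1) * (2 ^ (2 * k - 2 * j) - 1) * z ^ j" .
  qed simp
  finally have "Y_k k z = of_real pi / 2 ^ (2 * k) * (2 * c) *
      (\<Sum>j=0..k. b j * (2 ^ (2 * j) - 1) * (2 ^ (2 * k - 2 * j) - 1) * z ^ j)"
    by (simp add: Y_k_def w_def)
  also have "of_real pi / 2 ^ (2 * k) * (2 * c) = of_real pi ^ (2 * k) / fact (2 * k)"
  proof -
    \<comment> \<open>The exponent \<open>2 * k - 1\<close> is a natural number difference, exact
      because \<open>k \<ge> 1\<close>.\<close>
    have "x / 2 ^ (2 * k) * (2 * (2 * x) ^ (2 * k - 1)) = x ^ (2 * k)" for x :: complex
    proof -
      have "2 * k = Suc (2 * k - 1)" using assms by simp
      then have "x ^ (2 * k) = x * x ^ (2 * k - 1)" "(2::complex) ^ (2 * k) = 2 * 2 ^ (2 * k - 1)"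
        by (metis power_Suc)+
      then show ?thesis by (simp add: power_mult_distrib)
    qed
    from this[of "of_real pi"] show ?thesis by (simp add: c_def)
  qed
  also have "\<dots> * (\<Sum>j=0..k. b j * (2 ^ (2 * j) - 1) * (2 ^ (2 * k - 2 * j) - 1) * z ^ j) = poly (Y_poly k) z"
    by (simp add: Y_poly_def poly_sum poly_monom b_def mult_ac)
  finally show ?thesis .
qed

text \<open>The end coefficients vanish through the factor \<open>2 ^ 0 - 1\<close>. In between, the
  binomial coefficient and the power of \<open>pi\<close> distribute over the two Bernoulli factors,
  and \<open>bernoulli_eq_odd_zeta\<close> applies to each.\<close>

lemma coeff_Y_poly:
  "coeff (Y_poly k) j = (if 1 \<le> j \<and> j < k
     then of_real (4 * (-1) ^ k * (odd_zeta (2 * j) * odd_zeta (2 * (k - j)))) else 0)"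
proof -
  define y where "y i = bernoulli (2 * i) * bernoulli (2 * k - 2 * i) *
                         (2 ^ (2 * i) - 1) * (2 ^ (2 * k - 2 * i) - 1) *
                         real ((2 * k) choose (2 * i))" for i
  have "coeff (Y_poly k) j = of_real pi ^ (2 * k) / fact (2 * k) *
      (\<Sum>i=0..k. if i = j then of_real (y i) else 0)"
    unfolding Y_poly_def coeff_smult coeff_sum coeff_monom
    by (intro arg_cong2[where f = "(*)"] sum.cong refl) (simp add: y_def)
  also have "\<dots> = (if j \<le> k then of_real (pi ^ (2 * k) / fact (2 * k) * y j) else 0)"
    by simp
  also have "\<dots> = (if 1 \<le> j \<and> j < k
     then of_real (4 * (-1) ^ k * (odd_zeta (2 * j) * odd_zeta (2 * (k - j)))) else 0)"
  proof (cases "1 \<le> j \<and> j < k")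
    case True
    define i where "i = k - j"
    have i: "i \<ge> 1" "k = i + j" using True by (auto simp: i_def)
    have choose: "real ((2 * k) choose (2 * j)) = fact (2 * k) / (fact (2 * j) * fact (2 * i))"
      using True by (subst binomial_fact) (auto simp: i_def right_diff_distrib')
    have "pi ^ (2 * k) / fact (2 * k) * y j =
        ((2 ^ (2 * j) - 1) * bernoulli (2 * j) / fact (2 * j) * pi ^ (2 * j)) *
        ((2 ^ (2 * i) - 1) * bernoulli (2 * i) / fact (2 * i) * pi ^ (2 * i))"
    proof -
      have "2 * k - 2 * j = 2 * i" "pi ^ (2 * k) = pi ^ (2 * j) * pi ^ (2 * i)"
        using i by (auto simp: power_add)
      then show ?thesis unfolding y_def choose by simp
    qed
    also have "\<dots> = (- 2 * (-1) ^ j * odd_zeta (2 * j)) * (- 2 * (-1) ^ i * odd_zeta (2 * i))"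
      using True i by (simp only: bernoulli_eq_odd_zeta)
    also have "\<dots> = 4 * (-1) ^ k * (odd_zeta (2 * j) * odd_zeta (2 * i))"
      using i by (simp add: power_add)
    finally show ?thesis using True unfolding i_def by simp
  next
    case False
    then have "j = 0 \<or> j = k" if "j \<le> k" using that by auto
    then have "y j = 0" if "j \<le> k" using that by (auto simp: y_def)
    then show ?thesis using False by auto
  qed
  finally show ?thesis .
qed

section \<open>Size of the coefficients and conclusion\<close>

text \<open>Writing each factor as \<open>1 + \<mu>\<close>, the summand is the sum of two
  \<open>\<mu>\<close> terms and their product. Every \<open>\<mu>\<close> and their total are at
  most 1/4, so the whole is at most 1/4 + 1/4 + 1/16.\<close>

lemma sum_odd_zeta_products_close:
  "(\<Sum>j=1..K. odd_zeta (2 * j) * odd_zeta (2 * (Suc K - j)) - 1) < 1"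
proof -
  define \<mu> where "\<mu> j = odd_zeta (2 * j) - 1" for j
  have \<mu>0: "\<mu> j \<ge> 0" if "j \<ge> 1" for j using odd_zeta_ge_1[of "2 * j"] that by (simp add: \<mu>_def)
  have S: "(\<Sum>j=1..n. \<mu> j) \<le> 1 / 4" for n unfolding \<mu>_def by (rule sum_odd_zeta_minus_1_le)
  have \<mu>1: "\<mu> j \<le> 1 / 4" if "j \<ge> 1" for j
  proof -
    have "\<mu> j \<le> (\<Sum>i=1..j. \<mu> i)" using that \<mu>0 by (intro member_le_sum) auto
    then show ?thesis using S[of j] by linarith
  qed
  have rev: "(\<Sum>j=1..K. \<mu> (Suc K - j)) = (\<Sum>j=1..K. \<mu> j)"
    by (rule sum.reindex_bij_witness[of _ "\<lambda>j. Suc K - j" "\<lambda>j. Suc K - j"]) auto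
  have "(\<Sum>j=1..K. odd_zeta (2 * j) * odd_zeta (2 * (Suc K - j)) - 1)
      \<le> (\<Sum>j=1..K. \<mu> j + \<mu> (Suc K - j) + 1 / 4 * \<mu> j)"
  proof (rule sum_mono)
    fix j assume j: "j \<in> {1..K}"
    have "\<mu> j * \<mu> (Suc K - j) \<le> \<mu> j * (1 / 4)"
      using j \<mu>0[of j] \<mu>1[of "Suc K - j"] by (intro mult_left_mono) auto
    moreover have "odd_zeta (2 * j) * odd_zeta (2 * (Suc K - j)) - 1 = \<mu> j + \<mu> (Suc K - j) + \<mu> j * \<mu> (Suc K - j)"
      by (simp add: \<mu>_def algebra_simps)
    ultimately show "odd_zeta (2 * j) * odd_zeta (2 * (Suc K - j)) - 1 \<le> \<mu> j + \<mu> (Suc K - j) + 1 / 4 * \<mu> j"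
      by linarith
  qed
  also have "\<dots> = (\<Sum>j=1..K. \<mu> j) + (\<Sum>j=1..K. \<mu> j) + 1 / 4 * (\<Sum>j=1..K. \<mu> j)"
    by (simp only: sum.distrib rev sum_distrib_left)
  also have "\<dots> < 1" using S[of K] by linarith
  finally show ?thesis .
qed

theorem theorem2:
  fixes k :: nat
  assumes "k \<ge> 2"
  shows "(\<forall>z. Y_k k z = poly (Y_poly k) z) \<and>
         (\<forall>z. Y_k k z = 0 \<and> z \<noteq> 0 \<longrightarrow> cmod z = 1) \<and>
         (\<forall>z. Y_k k z = 0 \<longrightarrow> order z (Y_poly k) = 1)"
proof -
  define m where "m = k - 2"
  have k: "k = Suc (Suc m)" using assms by (simp add: m_def)
  \<comment> \<open>The coefficient of degree \<open>j + 1\<close> without its constant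
    \<open>4 * (-1) ^ k\<close>; the shift divides out the root 0, leaving degree
    \<open>m\<close>.\<close>
  define a where "a j = odd_zeta (2 * Suc j) * odd_zeta (2 * Suc (m - j))" for j
  have a1: "a j \<ge> 1" for j
    using mult_mono[OF odd_zeta_ge_1[of "2 * Suc j"] odd_zeta_ge_1[of "2 * Suc (m - j)"]]
    by (simp add: a_def odd_zeta_ge_1 order_trans[OF zero_le_one])
  have "(\<Sum>j\<le>m. \<bar>a j - 1\<bar>) = (\<Sum>j=1..Suc m. odd_zeta (2 * j) * odd_zeta (2 * (Suc (Suc m) - j)) - 1)"
    unfolding One_nat_def sum.atLeast1_atMost_eq lessThan_Suc_atMost using a1
    by (intro sum.cong refl) (simp add: a_def Suc_diff_le)
  then have close: "(\<Sum>j\<le>m. \<bar>a j - 1\<bar>) < 1"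
    using sum_odd_zeta_products_close[of "Suc m"] by simp
  obtain R where R: "finite R" "card R = m"
    "\<And>z. z \<in> R \<Longrightarrow> cmod z = 1 \<and> (\<Sum>j\<le>m. of_real (a j) * z ^ j) = 0"
    using palindromic_near_geometric_roots[of m a, OF _ close] by (auto simp: a_def)
  have coeff_Suc: "coeff (Y_poly k) (Suc j) = (if j \<le> m then 4 * (-1) ^ k * of_real (a j) else 0)" for j
    unfolding coeff_Y_poly by (auto simp: k a_def Suc_diff_le)
  have nz: "coeff (Y_poly k) (Suc m) \<noteq> 0"
    using a1[of m] by (simp add: coeff_Suc)
  have deg: "degree (Y_poly k) = Suc m"
  proof (rule antisym)
    show "degree (Y_poly k) \<le> Suc m" by (rule degree_le) (auto simp: coeff_Y_poly k)
    show "Suc m \<le> degree (Y_poly k)" using nz by (rule le_degree)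
  qed
  have poly_eq: "poly (Y_poly k) z = 4 * (-1) ^ k * z * (\<Sum>j\<le>m. of_real (a j) * z ^ j)" for z
  proof -
    have "poly (Y_poly k) z = (\<Sum>j\<le>Suc m. coeff (Y_poly k) j * z ^ j)"
      by (simp only: poly_altdef deg)
    also have "\<dots> = (\<Sum>j\<le>m. 4 * (-1) ^ k * z * (of_real (a j) * z ^ j))"
      unfolding sum.atMost_Suc_shift by (simp add: coeff_Y_poly[of k 0] coeff_Suc mult_ac)
    finally show ?thesis by (simp only: sum_distrib_left)
  qed
  \<comment> \<open>Together with 0, the \<open>m\<close> roots on the circle match the degree
    \<open>m + 1\<close>, so all roots are found and simple.\<close>
  have "0 \<notin> R" using R(3) by force
  then have "card (insert 0 R) = degree (Y_poly k)" using R by (simp add: deg)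
  moreover have "insert 0 R \<subseteq> {z. poly (Y_poly k) z = 0}" using R(3) by (auto simp: poly_eq)
  moreover have "Y_poly k \<noteq> 0" using nz by auto
  ultimately have roots: "{z. poly (Y_poly k) z = 0} = insert 0 R"
    and simple: "\<And>z. poly (Y_poly k) z = 0 \<Longrightarrow> order z (Y_poly k) = 1"
    using order_eq_1_if_card_roots by blast+
  have "Y_k k z = poly (Y_poly k) z" for z using assms by (intro Y_k_eq_poly) simp
  then show ?thesis using roots simple R(3) by auto
qed

end
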